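(* Let $n\ge2$ and $h\in C^1(\mathbb{R})$ be such that $$\lambda t^{k_1}\le h'(t)\le\Lambda(t^{k_2}+1)\qquad\forall\,t\ge0,$$ where $\Lambda>\lambda>0$, $k_1$ and $k_2$ are constants such that $0\le k_1\le k_2<k_1+1$. Then the function $\sigma\colon\mathbb{M}^{n\times n}\to\mathbb{M}^{n\times n}$, $\sigma(A)=h(\det A)\operatorname{cof}A$, is not quasimonotone at the identity matrix $I\in\mathbb{M}^{n\times n}$.
   Context: $\mathbb{M}^{n\times n}$ is the space of real $n\times n$ matrices with inner product $A:B=\sum_{i,j}A^i_jB^i_j$, and $\operatorname{cof}A$ is the cofactor matrix, so that $A^T\operatorname{cof}A=(\det A)I$. A function $\sigma\colon\mathbb{M}^{n\times n}\to\mathbb{M}^{n\times n}$ is quasimonotone at $A\in\mathbb{M}^{n\times n}$ if, for a bounded domain $\Omega\subset\mathbb{R}^n$, $\int_\Omega\sigma(A+D\phi(x)):D\phi(x)\,dx\ge0$ for all $\phi\in C^1_c(\Omega;\mathbb{R}^n)$; this condition is independent of the domain $\Omega$. *)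

theory Defs
  imports "HOL-Analysis.Analysis"
begin

text \<open>
  Matrices are \<open>real^'n^'n\<close> with \<open>A$i$j\<close> the entry in row \<open>i\<close> and column \<open>j\<close>.  The library's
  inner product on this type, \<open>A \<bullet> B\<close>, is the Frobenius product, and the entry \<open>$i$j\<close> of
  \<open>jacobian \<phi> (at x)\<close> is the partial derivative of the \<open>i\<close>-th component of \<open>\<phi>\<close> in direction \<open>j\<close>.
\<close>

lemma matrix_inner_eq: "A \<bullet> B = (\<Sum>i\<in>UNIV. \<Sum>j\<in>UNIV. A$i$j * B$i$j)"
  for A B :: "real^'n^'n"
  by (simp add: inner_vec_def)

text \<open>
  The index type carries no order, so the sign of a cofactor cannot be written as a power of
  \<open>-1\<close>.  Instead, column \<open>j\<close> of \<open>A\<close> is replaced by the \<open>i\<close>-th unit vector; expanding that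
  determinant along column \<open>j\<close> gives the minor of \<open>A\<close> at \<open>(i, j)\<close> with its sign.
\<close>

definition cof :: "real^'n^'n \<Rightarrow> real^'n^'n" where
  "cof A = (\<chi> i j. det (\<chi> k l. if l = j then (if k = i then 1 else 0) else A$k$l))"

lemma transpose_mult_cof: "transpose A ** cof A = det A *\<^sub>R mat 1"
  for A :: "real^'n^'n"
proof -
  have "(\<Sum>k\<in>UNIV. A$k$i * cof A$k$j) = det A * (if i = j then 1 else 0)" for i j
  proof -
    define u :: "'n \<Rightarrow> real^'n" where "u k = axis k 1" for k
    have cof_eq: "cof A$k$j = det (\<chi> l. if l = j then u k else column l A)" for k
      unfolding cof_def u_def
      by (subst det_transpose [symmetric], unfold vec_lambda_beta, rule arg_cong [where f = det])
         (auto simp: vec_eq_iff transpose_def column_def axis_def)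
    have "(\<Sum>k\<in>UNIV. A$k$i * cof A$k$j)
        = (\<Sum>k\<in>UNIV. det (\<chi> l. if l = j then A$k$i *s u k else column l A))"
      unfolding cof_eq by (simp add: det_row_mul)
    also have "\<dots> = det (\<chi> l. if l = j then (\<Sum>k\<in>UNIV. A$k$i *s u k) else column l A)"
      by (subst det_linear_row_sum) auto
    also have "(\<Sum>k\<in>UNIV. A$k$i *s u k) = column i A"
      using basis_expansion [of "column i A"] by (simp add: column_def u_def)
    also have "det (\<chi> l. if l = j then column i A else column l A)
        = det (\<chi> k l. if l = j then (A *v axis i 1)$k else A$k$l)"
      by (subst det_transpose [symmetric], rule arg_cong [where f = det])
         (auto simp: vec_eq_iff transpose_def column_def matrix_vector_mult_basis)
    also have "\<dots> = det A * (if i = j then 1 else 0)"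
      by (subst cramer_lemma) (auto simp: axis_def)
    finally show ?thesis .
  qed
  then show ?thesis
    by (auto simp: vec_eq_iff matrix_matrix_mult_def transpose_def mat_def)
qed

text \<open>Elements of \<open>C\<^sup>1\<^sub>c(\<Omega>; \<real>\<^sup>n)\<close>, extended by zero to the whole space.\<close>

definition C1c :: "(real^'n) set \<Rightarrow> (real^'n \<Rightarrow> real^'n) set" where
  "C1c \<Omega> = {\<phi>. (\<forall>x. \<phi> differentiable (at x)) \<and>
     continuous_on UNIV (\<lambda>x. jacobian \<phi> (at x)) \<and>
     compact (closure {x. \<phi> x \<noteq> 0}) \<and> closure {x. \<phi> x \<noteq> 0} \<subseteq> \<Omega>}"

definition bounded_domain :: "(real^'n) set \<Rightarrow> bool" where
  "bounded_domain \<Omega> \<longleftrightarrow> open \<Omega> \<and> connected \<Omega> \<and> bounded \<Omega> \<and> \<Omega> \<noteq> {}"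

definition quasimonotone_on ::
  "(real^'n) set \<Rightarrow> (real^'n^'n \<Rightarrow> real^'n^'n) \<Rightarrow> real^'n^'n \<Rightarrow> bool" where
  "quasimonotone_on \<Omega> \<sigma> A \<longleftrightarrow> (\<forall>\<phi>\<in>C1c \<Omega>.
     (LINT x:\<Omega>|lborel. \<sigma> (A + jacobian \<phi> (at x)) \<bullet> jacobian \<phi> (at x)) \<ge> 0)"

text \<open>
  The choice of the domain does not matter for continuous \<open>\<sigma>\<close>
  (\<open>quasimonotone_on_domain_independent\<close> below).  With the existential quantifier, the negation
  says that the inequality fails for some test function on every bounded domain.
\<close>

definition quasimonotone_at :: "(real^'n^'n \<Rightarrow> real^'n^'n) \<Rightarrow> real^'n^'n \<Rightarrow> bool" where
  "quasimonotone_at \<sigma> A \<longleftrightarrow> (\<exists>\<Omega>. bounded_domain \<Omega> \<and> quasimonotone_on \<Omega> \<sigma> A)"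

lemma jacobian_zero_outside:
  fixes \<phi> :: "real^'n \<Rightarrow> real^'n"
  assumes "x \<notin> closure {x. \<phi> x \<noteq> 0}"
  shows "jacobian \<phi> (at x) = 0"
proof -
  have "(\<phi> has_derivative (\<lambda>_. 0)) (at x)"
  proof (rule has_derivative_transform_within_open)
    show "((\<lambda>_. 0) has_derivative (\<lambda>_. 0)) (at x)" by simp
    show "open (- closure {x. \<phi> x \<noteq> 0})" by (simp only: open_Compl closed_closure)
    show "0 = \<phi> y" if "y \<in> - closure {x. \<phi> x \<noteq> 0}" for y
      using that closure_subset [of "{x. \<phi> x \<noteq> 0}"] by auto
  qed (use assms in auto)
  then have "frechet_derivative \<phi> (at x) = (\<lambda>_. 0)"
    by (metis frechet_derivative_at)
  then show ?thesis
    by (simp add: jacobian_def matrix_def vec_eq_iff)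
qed

lemma set_integral_C1c:
  assumes "\<phi> \<in> C1c \<Omega>"
  shows "(LINT x:\<Omega>|lborel. \<sigma> (A + jacobian \<phi> (at x)) \<bullet> jacobian \<phi> (at x))
       = (LINT x|lborel. \<sigma> (A + jacobian \<phi> (at x)) \<bullet> jacobian \<phi> (at x))"
  unfolding set_lebesgue_integral_def
proof (rule Bochner_Integration.integral_cong [OF refl])
  fix x
  show "indicator \<Omega> x *\<^sub>R (\<sigma> (A + jacobian \<phi> (at x)) \<bullet> jacobian \<phi> (at x))
      = \<sigma> (A + jacobian \<phi> (at x)) \<bullet> jacobian \<phi> (at x)"
  proof (cases "x \<in> \<Omega>")
    case False
    then have "jacobian \<phi> (at x) = 0"
      using assms by (intro jacobian_zero_outside) (auto simp: C1c_def)
    then show ?thesis by simp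
  qed simp
qed

lemma quasimonotone_on_domain_change:
  fixes \<sigma> :: "real^'n^'n \<Rightarrow> real^'n^'n"
  assumes cont: "continuous_on UNIV \<sigma>"
    and dom: "bounded_domain \<Omega>" "bounded_domain \<Omega>'"
    and qm: "quasimonotone_on \<Omega> \<sigma> A"
  shows "quasimonotone_on \<Omega>' \<sigma> A"
  unfolding quasimonotone_on_def
proof
  fix \<phi> assume \<phi>: "\<phi> \<in> C1c \<Omega>'"
  let ?J = "\<lambda>x. jacobian \<phi> (at x)"
  define F where "F x = \<sigma> (A + ?J x) \<bullet> ?J x" for x
  have diff: "\<And>x. \<phi> differentiable (at x)" and contJ: "continuous_on UNIV ?J"
    and cpt: "compact (closure {x. \<phi> x \<noteq> 0})" and supp: "closure {x. \<phi> x \<noteq> 0} \<subseteq> \<Omega>'"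
    using \<phi> by (auto simp: C1c_def)
  obtain z r where r: "r > 0" "ball z r \<subseteq> \<Omega>"
    using dom(1) unfolding bounded_domain_def by (meson all_not_in_conv open_contains_ball)
  obtain R where R: "R > 0" "\<Omega>' \<subseteq> ball 0 R"
    using dom(2) unfolding bounded_domain_def by (meson bounded_subset_ballD)
  define c where "c = R / r"
  have c: "c > 0" using r R by (simp add: c_def)
  define T where "T x = - (c *\<^sub>R z) + c *\<^sub>R x" for x :: "real^'n"
  define S where "S y = z + (1/c) *\<^sub>R y" for y :: "real^'n"
  have TS: "T (S y) = y" and ST: "S (T x) = x" for x y
    using c by (auto simp: T_def S_def algebra_simps)
  define \<psi> where "\<psi> x = (1/c) *\<^sub>R \<phi> (T x)" for x
  have dT: "(T has_derivative (\<lambda>h. c *\<^sub>R h)) (at x)" for x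
    unfolding T_def by (auto intro!: derivative_eq_intros)
  have d\<psi>: "(\<psi> has_derivative (\<lambda>h. ?J (T x) *v h)) (at x)" for x
  proof -
    have "(\<phi> has_derivative (\<lambda>h. ?J (T x) *v h)) (at (T x))"
      using diff jacobian_works by blast
    from has_derivative_compose [OF dT this]
    have "((\<lambda>x. (1/c) *\<^sub>R \<phi> (T x)) has_derivative (\<lambda>h. (1/c) *\<^sub>R (?J (T x) *v (c *\<^sub>R h)))) (at x)"
      by (rule has_derivative_scaleR_right)
    then show ?thesis
      using c by (simp add: \<psi>_def [abs_def] matrix_vector_mult_scaleR)
  qed
  have J\<psi>: "jacobian \<psi> (at x) = ?J (T x)" for x
    by (metis frechet_derivative_at [OF d\<psi>] jacobian_def matrix_of_matrix_vector_mul)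
  have suppS: "closure {x. \<psi> x \<noteq> 0} \<subseteq> S ` closure {x. \<phi> x \<noteq> 0}"
  proof (rule closure_minimal)
    show "{x. \<psi> x \<noteq> 0} \<subseteq> S ` closure {x. \<phi> x \<noteq> 0}"
    proof
      fix x assume "x \<in> {x. \<psi> x \<noteq> 0}"
      then have "T x \<in> closure {x. \<phi> x \<noteq> 0}"
        using closure_subset [of "{x. \<phi> x \<noteq> 0}"] by (auto simp: \<psi>_def)
      then show "x \<in> S ` closure {x. \<phi> x \<noteq> 0}" using ST by (metis imageI)
    qed
    show "closed (S ` closure {x. \<phi> x \<noteq> 0})"
      unfolding S_def by (intro compact_imp_closed compact_continuous_image cpt continuous_intros)
  qed
  have SK: "S ` closure {x. \<phi> x \<noteq> 0} \<subseteq> \<Omega>"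
  proof -
    have "S y \<in> ball z r" if "y \<in> closure {x. \<phi> x \<noteq> 0}" for y
    proof -
      have "norm y < R" using that supp R by auto
      then show ?thesis
        using c r R by (auto simp: S_def dist_norm c_def field_simps)
    qed
    then show ?thesis using r by blast
  qed
  have \<psi>: "\<psi> \<in> C1c \<Omega>"
    unfolding C1c_def
  proof (intro CollectI conjI allI)
    show "\<psi> differentiable (at x)" for x using d\<psi> differentiableI by blast
    show "continuous_on UNIV (\<lambda>x. jacobian \<psi> (at x))"
      unfolding J\<psi> T_def
      by (rule continuous_on_compose2 [OF contJ]) (auto intro!: continuous_intros)
    show "compact (closure {x. \<psi> x \<noteq> 0})"
    proof -
      have "compact (S ` closure {x. \<phi> x \<noteq> 0})"
        unfolding S_def by (intro compact_continuous_image cpt continuous_intros)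
      from compact_Int_closed [OF this closed_closure] show ?thesis
        using suppS by (metis inf.absorb2)
    qed
    show "closure {x. \<psi> x \<noteq> 0} \<subseteq> \<Omega>" using suppS SK by blast
  qed
  have "0 \<le> (LINT x:\<Omega>|lborel. \<sigma> (A + jacobian \<psi> (at x)) \<bullet> jacobian \<psi> (at x))"
    using qm \<psi> unfolding quasimonotone_on_def by blast
  then have "0 \<le> (LINT x|lborel. F (T x))"
    unfolding set_integral_C1c [OF \<psi>] by (simp add: F_def J\<psi>)
  moreover have "(LINT x|lborel. F x) = c ^ DIM(real^'n) * (LINT x|lborel. F (T x))"
  proof -
    have "continuous_on UNIV F"
      unfolding F_def
      by (intro continuous_intros contJ continuous_on_compose2 [OF cont]) auto
    then have F: "F \<in> borel_measurable borel"
      by (rule borel_measurable_continuous_onI)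
    have T: "T \<in> borel_measurable borel"
      unfolding T_def by measurable
    have "(LINT x|lborel. F x)
        = (LINT x|density (distr lborel borel T) (\<lambda>_. \<bar>c\<bar> ^ DIM(real^'n)). F x)"
      using c unfolding T_def
      by (subst lborel_affine [of c "- (c *\<^sub>R z)"]) auto
    also have "\<dots> = (LINT x|distr lborel borel T. c ^ DIM(real^'n) *\<^sub>R F x)"
      using c F by (subst integral_density) auto
    also have "\<dots> = (LINT x|lborel. c ^ DIM(real^'n) *\<^sub>R F (T x))"
      using F T by (subst integral_distr) auto
    finally show ?thesis by simp
  qed
  ultimately have "0 \<le> (LINT x|lborel. F x)"
    using c by simp
  then show "0 \<le> (LINT x:\<Omega>'|lborel. \<sigma> (A + ?J x) \<bullet> ?J x)"
    using set_integral_C1c [OF \<phi>, of \<sigma> A] by (simp add: F_def)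
qed

corollary quasimonotone_on_domain_independent:
  fixes \<sigma> :: "real^'n^'n \<Rightarrow> real^'n^'n"
  assumes "continuous_on UNIV \<sigma>" "bounded_domain \<Omega>"
  shows "quasimonotone_at \<sigma> A \<longleftrightarrow> quasimonotone_on \<Omega> \<sigma> A"
  using quasimonotone_on_domain_change assms unfolding quasimonotone_at_def by blast

text \<open>
  Real powers of \<open>t \<ge> 0\<close> with the convention \<open>0\<^sup>0 = 1\<close>; the library has \<open>0 powr 0 = 0\<close>.
\<close>

definition rpow :: "real \<Rightarrow> real \<Rightarrow> real" where
  "rpow t k = (if k = 0 then 1 else t powr k)"

end

theory Submission
  imports Defs
begin

text \<open>
  The test function comes from a radial deformation \<open>u(x) = p(|x|\<^sup>2) x\<close> with \<open>p > 0\<close> nondecreasing and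
  \<open>p = 1\<close> for \<open>|x|\<^sup>2 \<ge> 3\<close>, so that \<open>\<phi> = u - id\<close> has compact support.  Put \<open>N = |x|\<^sup>2\<close>, \<open>a = p(N)\<close> and
  \<open>b = 2 N p'(N)\<close>.  The gradient \<open>F = Du = a I + 2 p'(N) x x\<^sup>T\<close> has the eigenvalue \<open>a\<close> on the
  orthogonal complement of \<open>x\<close> and \<open>a + b\<close> on \<open>x\<close>.  Hence \<open>det F = a\<^bsup>n-1\<^esup> (a + b)\<close> and
  \<open>cof F : (F - I) = a\<^bsup>n-2\<^esup> (n a (a - 1) + b (n a - (n - 1)))\<close>,
  and the integrand of the quasimonotonicity inequality is \<open>h (det F)\<close> times the latter.

  The factor of \<open>b\<close> is negative once \<open>a < 1 - 1/n\<close>: where \<open>u\<close> contracts strongly in the tangential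
  directions, stretching it in the radial direction makes the determinant large and
  \<open>cof F : (F - I)\<close> very negative.  This is exploited by letting \<open>p\<close> rise from \<open>1/8\<close> to \<open>1/4\<close>
  within a shell of thickness of order \<open>1/M\<close>, and then from \<open>1/4\<close> to \<open>1\<close> by a profile that does
  not depend on \<open>M\<close>.  In the middle of the shell, \<open>b\<close> is of order \<open>M\<close>, so the integrand is at most
  \<open>- c M h(c M)\<close> on a set of measure of order \<open>1/M\<close>; this contributes at most \<open>- c' h(c M)\<close>,
  which tends to \<open>-\<infinity>\<close> because \<open>h\<close> is unbounded.  Everywhere else the integrand is bounded above
  independently of \<open>M\<close>: either \<open>b\<close> is bounded and a compactness argument applies, or \<open>b\<close> is so
  large that \<open>h (det F) \<ge> 0\<close>, which happens only where \<open>a \<le> 1/4\<close>, and then the integrand is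
  nonpositive.  For large \<open>M\<close> the integral is negative.

  The two bounds on the integrand are \<open>radial_density_bounded\<close> and \<open>radial_density_le\<close>; they are
  combined in \<open>not_quasimonotone_at_id_if_mono_unbounded\<close>, which treats every continuous \<open>h\<close> that
  is nondecreasing and unbounded on \<open>[0, \<infinity>)\<close>.
\<close>

section \<open>Rank-one perturbations of multiples of the identity\<close>

definition dyad :: "real^'n \<Rightarrow> real^'n^'n" where
  "dyad x = (\<chi> i j. x$i * x$j)"

lemma dyad_mult_vec: "dyad x *v y = (x \<bullet> y) *\<^sub>R x"
  by (simp add: vec_eq_iff dyad_def matrix_vector_mult_def inner_vec_def sum_distrib_left
      mult_ac)

lemma dyad_mult_dyad: "dyad x ** dyad x = (x \<bullet> x) *\<^sub>R dyad x"
  by (simp add: vec_eq_iff dyad_def matrix_matrix_mult_def inner_vec_def sum_distrib_left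
      sum_distrib_right mult_ac)

lemma dyad_matrix_vec: "dyad (A *v x) = A ** dyad x ** transpose A"
  by (simp add: vec_eq_iff dyad_def matrix_matrix_mult_def matrix_vector_mult_def transpose_def
      sum_distrib_left sum_distrib_right mult_ac)

lemma matrix_mult_add_right_distrib: "(A + B) ** C = A ** C + B ** C"
  for A B :: "real^'m^'n"
  by (vector matrix_matrix_mult_def sum.distrib[symmetric] field_simps)

lemma mult_scale_id_plus_dyad:
  "(a *\<^sub>R mat 1 + b *\<^sub>R dyad x) ** (c *\<^sub>R mat 1 + d *\<^sub>R dyad x)
    = (a * c) *\<^sub>R mat 1 + (a * d + b * c + b * d * (x \<bullet> x)) *\<^sub>R dyad x"
  by (simp add: matrix_add_ldistrib matrix_mult_add_right_distrib matrix_scalar_ac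
      dyad_mult_dyad algebra_simps flip: scalar_matrix_assoc)

lemma inner_mat1_mat1: "mat 1 \<bullet> (mat 1 :: real^'n^'n) = real CARD('n)"
  by (simp add: matrix_inner_eq mat_def if_distrib cong: if_cong)

lemma inner_mat1_dyad: "mat 1 \<bullet> dyad x = x \<bullet> x"
proof -
  have "mat 1 \<bullet> dyad x = (\<Sum>i\<in>UNIV. \<Sum>j\<in>UNIV. if i = j then x$i * x$j else 0)"
    unfolding matrix_inner_eq by (intro sum.cong) (auto simp: mat_def dyad_def)
  then show ?thesis by (simp add: inner_vec_def)
qed

lemma inner_dyad_dyad: "dyad x \<bullet> dyad x = (x \<bullet> x)\<^sup>2"
  by (simp add: matrix_inner_eq dyad_def inner_vec_def power2_eq_square sum_product mult_ac)

text \<open>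
  After a rotation that takes \<open>x\<close> to a multiple of a basis vector the matrix is diagonal, with one
  entry \<open>a + \<beta> |x|\<^sup>2\<close> and all others equal to \<open>a\<close>.
\<close>

lemma det_scale_id_plus_dyad:
  fixes x :: "real^'n"
  shows "det (a *\<^sub>R mat 1 + \<beta> *\<^sub>R dyad x) = a ^ (CARD('n) - 1) * (a + \<beta> * (x \<bullet> x))"
proof -
  obtain c :: real and y where y: "norm y = 1" "x = c *\<^sub>R y"
  proof (cases "x = 0")
    case True
    then show ?thesis
      using that [of "axis undefined 1" 0] by simp
  next
    case False
    then show ?thesis
      using that [of "x /\<^sub>R norm x" "norm x"] by simp
  qed
  fix k :: 'n
  obtain A where A: "orthogonal_matrix A" "A *v axis k 1 = y"
    using orthogonal_matrix_exists_basis [OF y(1)] by metis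
  have AA: "A ** transpose A = mat 1"
    using A(1) by (simp add: orthogonal_matrix_def)
  define b where "b = \<beta> * c\<^sup>2"
  define D where "D = a *\<^sub>R mat 1 + b *\<^sub>R dyad (axis k 1)"
  have "dyad x = c\<^sup>2 *\<^sub>R dyad y"
    by (simp add: y(2) dyad_def vec_eq_iff power2_eq_square)
  then have "a *\<^sub>R mat 1 + \<beta> *\<^sub>R dyad x = A ** D ** transpose A"
    unfolding D_def b_def
    by (simp add: A(2) [symmetric] dyad_matrix_vec matrix_add_ldistrib
        matrix_mult_add_right_distrib matrix_scalar_ac AA flip: scalar_matrix_assoc)
  then have "det (a *\<^sub>R mat 1 + \<beta> *\<^sub>R dyad x) = det (A ** transpose A) * det D"
    by (simp add: det_mul)
  also have "\<dots> = det D"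
    by (simp add: AA)
  also have "\<dots> = (\<Prod>i\<in>UNIV. D $ i $ i)"
    by (rule det_diagonal) (auto simp: D_def mat_def dyad_def axis_def)
  also have "\<dots> = (\<Prod>i\<in>UNIV. if i = k then a + b else a)"
    by (intro prod.cong) (auto simp: D_def mat_def dyad_def axis_def)
  also have "\<dots> = (a + b) * a ^ (CARD('n) - 1)"
    by (subst prod.remove [of _ k]) (auto simp: card_Diff_singleton)
  also have "b = \<beta> * (x \<bullet> x)"
    using y by (simp add: b_def power2_norm_eq_inner [symmetric] power_mult_distrib)
  finally show ?thesis by simp
qed

lemma cof_eq_det_inverse_transpose:
  fixes A X :: "real^'n^'n"
  assumes "X ** transpose A = mat 1"
  shows "cof A = det A *\<^sub>R X"
proof -
  have "cof A = X ** (transpose A ** cof A)"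
    by (simp add: matrix_mul_assoc assms)
  also have "\<dots> = det A *\<^sub>R X"
    unfolding transpose_mult_cof
    by (simp add: matrix_scalar_ac)
  finally show ?thesis .
qed

text \<open>
  The inverse of \<open>F = a I + \<beta> x x\<^sup>T\<close> is again of the form \<open>(1/a) I + \<gamma> x x\<^sup>T\<close>
  (Sherman-Morrison), so its product with \<open>F - I\<close> is explicit.
\<close>

lemma cof_inner_scale_id_plus_dyad:
  fixes x :: "real^'n"
  assumes n: "CARD('n) \<ge> 2" and a: "a > 0" and b: "b = \<beta> * (x \<bullet> x)" "b \<ge> 0"
  defines "F \<equiv> a *\<^sub>R mat 1 + \<beta> *\<^sub>R dyad x"
  shows "cof F \<bullet> (F - mat 1)
    = a ^ (CARD('n) - 2) * (real CARD('n) * a * (a - 1)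
        + b * (real CARD('n) * a - (real CARD('n) - 1)))"
proof -
  have F1: "F - mat 1 = (a - 1) *\<^sub>R mat 1 + \<beta> *\<^sub>R dyad x"
    by (simp add: F_def algebra_simps)
  define \<gamma> where "\<gamma> = - \<beta> / (a * (a + b))"
  define X where "X = (1/a) *\<^sub>R mat 1 + \<gamma> *\<^sub>R dyad x"
  have "transpose F = F"
    by (simp add: F_def vec_eq_iff transpose_def mat_def dyad_def)
  then have "X ** transpose F
      = (1/a * a) *\<^sub>R mat 1 + (1/a * \<beta> + \<gamma> * a + \<gamma> * \<beta> * (x \<bullet> x)) *\<^sub>R dyad x"
    unfolding X_def F_def by (simp only: mult_scale_id_plus_dyad)
  also have "1/a * \<beta> + \<gamma> * a + \<gamma> * \<beta> * (x \<bullet> x) = \<beta>/a + \<gamma> * (a + b)"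
    by (simp add: b(1) algebra_simps)
  also have "\<dots> = 0"
    using a b(2) by (simp add: \<gamma>_def)
  finally have "X ** transpose F = mat 1" using a by simp
  then have "cof F \<bullet> (F - mat 1) = det F * (X \<bullet> (F - mat 1))"
    by (simp add: cof_eq_det_inverse_transpose)
  also have "X \<bullet> (F - mat 1)
      = (CARD('n) * (a - 1) + b) / a + \<gamma> * (x \<bullet> x) * (a - 1 + b)"
    unfolding F1 by (simp add: X_def inner_add_left inner_add_right inner_mat1_mat1 inner_mat1_dyad
        inner_dyad_dyad inner_commute [of "dyad x" "mat 1"] b(1) power2_eq_square algebra_simps
        add_divide_distrib diff_divide_distrib)
  also have "\<gamma> * (x \<bullet> x) = - (b / (a * (a + b)))"
    by (simp add: \<gamma>_def b(1))
  also have "det F = a ^ (CARD('n) - 1) * (a + b)"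
    unfolding F_def b(1) by (rule det_scale_id_plus_dyad)
  also have "a ^ (CARD('n) - 1) = a ^ (CARD('n) - 2) * a"
  proof -
    have "CARD('n) - 1 = Suc (CARD('n) - 2)" using n by linarith
    then show ?thesis by (simp only: power_Suc2)
  qed
  also have "a ^ (CARD('n) - 2) * a * (a + b)
      * ((CARD('n) * (a - 1) + b) / a + - (b / (a * (a + b))) * (a - 1 + b))
      = a ^ (CARD('n) - 2) * ((a + b) * (CARD('n) * (a - 1) + b) - b * (a - 1 + b))"
  proof -
    have "a * s * (U / a + - (b / (a * s)) * V) = s * U - b * V" if "s > 0" for s U V :: real
      using a that by (simp add: field_simps)
    from this [of "a + b"] show ?thesis
      using a b(2) by (simp add: mult.assoc)
  qed
  also have "(a + b) * (CARD('n) * (a - 1) + b) - b * (a - 1 + b)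
      = CARD('n) * a * (a - 1) + b * (CARD('n) * a - (real CARD('n) - 1))"
    by (simp add: algebra_simps)
  finally show ?thesis .
qed

section \<open>Continuity of determinant and cofactor matrix\<close>

lemma continuous_on_cof: "continuous_on S (cof :: real^'n^'n \<Rightarrow> _)"
proof -
  have entry: "continuous_on S (\<lambda>A::real^'n^'n. if P then c else A$k$l)" for P c k l
  proof (cases P)
    case False
    have "continuous_on S (\<lambda>A::real^'n^'n. A$k$l)"
      by (rule continuous_on_component [OF continuous_on_component [OF continuous_on_id]])
    then show ?thesis using False by simp
  qed simp
  have "continuous_on S (\<lambda>A::real^'n^'n.
      det (\<chi> k l. if l = j then (if k = i then 1 else 0) else A$k$l))" for i j
    unfolding det_def vec_lambda_beta
    by (intro continuous_on_sum continuous_on_mult continuous_on_prod continuous_on_const entry)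
  then show ?thesis
    unfolding cof_def by (intro continuous_on_vec_lambda)
qed

lemma continuous_on_det: "continuous_on S (det :: real^'n^'n \<Rightarrow> _)"
  unfolding det_def
  by (intro continuous_on_sum continuous_on_mult continuous_on_prod continuous_on_const
      continuous_on_component continuous_on_id)

section \<open>A steep radial profile\<close>

lemma DERIV_max_0_power2:
  "((\<lambda>t::real. (max 0 t)\<^sup>2) has_real_derivative 2 * max 0 t) (at t)"
proof -
  consider "t > 0" | "t < 0" | "t = 0" by linarith
  then show ?thesis
  proof cases
    case 1
    have "((\<lambda>t::real. t\<^sup>2) has_real_derivative 2 * t) (at t)"
      by (auto intro!: derivative_eq_intros)
    then have "((\<lambda>t::real. (max 0 t)\<^sup>2) has_real_derivative 2 * t) (at t)"
      by (rule has_field_derivative_transform_within_open [where S = "{0<..}"]) (use 1 in auto)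
    then show ?thesis using 1 by simp
  next
    case 2
    have "((\<lambda>t::real. 0) has_real_derivative 0) (at t)"
      by simp
    then have "((\<lambda>t::real. (max 0 t)\<^sup>2) has_real_derivative 0) (at t)"
      by (rule has_field_derivative_transform_within_open [where S = "{..<0}"]) (use 2 in auto)
    then show ?thesis using 2 by simp
  next
    case 3
    have "((\<lambda>s::real. (max 0 s)\<^sup>2 / s) \<longlongrightarrow> 0) (at 0)"
    proof (rule Lim_null_comparison)
      show "\<forall>\<^sub>F s in at (0::real). norm ((max 0 s)\<^sup>2 / s) \<le> \<bar>s\<bar>"
        by (intro always_eventually) (auto simp: max_def power2_eq_square)
      show "((\<lambda>s::real. \<bar>s\<bar>) \<longlongrightarrow> 0) (at 0)"
        by (intro tendsto_eq_intros) auto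
    qed
    then show ?thesis using 3 by (simp add: has_field_derivative_iff)
  qed
qed

text \<open>
  A \<open>C\<^sup>1\<close> transition from \<open>0\<close> to \<open>1\<close> on \<open>[0, 1]\<close>.  Writing it with truncated squares instead of a case
  distinction reduces differentiability at the breakpoints to \<open>DERIV_max_0_power2\<close>; the derivative
  is the hat function with peak \<open>2\<close> at \<open>1/2\<close>.
\<close>

definition step :: "real \<Rightarrow> real" where
  "step t = 2 * (max 0 t)\<^sup>2 - 4 * (max 0 (t - 1/2))\<^sup>2 + 2 * (max 0 (t - 1))\<^sup>2"

definition step' :: "real \<Rightarrow> real" where
  "step' t = 4 * (max 0 t - 2 * max 0 (t - 1/2) + max 0 (t - 1))"

lemma DERIV_step: "(step has_real_derivative step' t) (at t)"
proof -
  have *: "((\<lambda>t. (max 0 (t - c))\<^sup>2) has_real_derivative 2 * max 0 (t - c)) (at t)" for c :: real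
  proof -
    have "((\<lambda>t. (max 0 (t - c))\<^sup>2) has_real_derivative 2 * max 0 (t - c) * 1) (at t)"
      by (rule DERIV_chain2 [OF DERIV_max_0_power2]) (auto intro!: derivative_eq_intros)
    then show ?thesis by simp
  qed
  show ?thesis
    unfolding step_def [abs_def] step'_def
    by (rule derivative_eq_intros DERIV_max_0_power2 * refl)+ simp
qed

lemma continuous_on_step': "continuous_on A step'"
  unfolding step'_def by (intro continuous_intros)

lemma step_eq_0: "step t = 0" if "t \<le> 0"
  using that by (simp add: step_def)

lemma step_eq_1: "step t = 1" if "t \<ge> 1"
  using that by (simp add: step_def power2_eq_square algebra_simps)

lemma step'_eq_0: "step' t = 0" if "t \<le> 0 \<or> t \<ge> 1"
  using that by (auto simp: step'_def)

lemma step'_nonneg: "0 \<le> step' t"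
  by (auto simp: step'_def max_def)

lemma step'_le_2: "step' t \<le> 2"
  by (auto simp: step'_def max_def)

lemma step'_ge_1: "1 \<le> step' t" if "1/4 \<le> t" "t \<le> 3/4"
  using that by (auto simp: step'_def max_def)

lemma step_mono: "s \<le> t \<Longrightarrow> step s \<le> step t"
  by (rule DERIV_nonneg_imp_nondecreasing) (use DERIV_step step'_nonneg in blast)+

lemma step_nonneg: "0 \<le> step t" and step_le_1: "step t \<le> 1"
  using step_mono [of "min 0 t" t] step_mono [of t "max 1 t"]
  by (simp_all add: step_eq_0 step_eq_1)

text \<open>
  The argument \<open>N\<close> stands for \<open>|x|\<^sup>2\<close>, which avoids derivatives of the norm.  The first
  step takes place in \<open>[1, 1 + 1/M]\<close> and is the steep one, the second in \<open>[2, 3]\<close>.  The value \<open>1/4\<close>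
  reached after the first step lies strictly below \<open>1 - 1/n\<close> for every \<open>n \<ge> 2\<close>, and the positive
  start \<open>1/8\<close> keeps the deformation gradient invertible.
\<close>

definition profile :: "real \<Rightarrow> real \<Rightarrow> real" where
  "profile M N = 1/8 + step (M * (N - 1)) / 8 + 3/4 * step (N - 2)"

definition profile' :: "real \<Rightarrow> real \<Rightarrow> real" where
  "profile' M N = M/8 * step' (M * (N - 1)) + 3/4 * step' (N - 2)"

lemma DERIV_profile: "(profile M has_real_derivative profile' M N) (at N)"
proof -
  have "((\<lambda>N. step (M * (N - 1))) has_real_derivative step' (M * (N - 1)) * M) (at N)"
    by (rule DERIV_chain2 [OF DERIV_step]) (auto intro!: derivative_eq_intros)
  moreover have "((\<lambda>N. step (N - 2)) has_real_derivative step' (N - 2) * 1) (at N)"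
    by (rule DERIV_chain2 [OF DERIV_step]) (auto intro!: derivative_eq_intros)
  ultimately show ?thesis
    unfolding profile_def [abs_def] profile'_def
    by (auto intro!: derivative_eq_intros)
qed

lemma continuous_on_profile': "continuous_on A (profile' M)"
  unfolding profile'_def
  by (intro continuous_intros continuous_on_compose2 [OF continuous_on_step' [of UNIV]]) auto

lemma profile_ge: "profile M N \<ge> 1/8"
  using step_nonneg [of "M * (N - 1)"] step_nonneg [of "N - 2"] by (simp add: profile_def)

lemma profile_le_1: "profile M N \<le> 1"
  using step_le_1 [of "M * (N - 1)"] step_le_1 [of "N - 2"] by (simp add: profile_def)

lemma profile_le: "profile M N \<le> 1/4" if "N \<le> 2"
  using step_le_1 [of "M * (N - 1)"] step_eq_0 [of "N - 2"] that by (simp add: profile_def)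

lemma profile'_nonneg: "profile' M N \<ge> 0" if "M \<ge> 0"
  using step'_nonneg that by (simp add: profile'_def)

text \<open>
  The steep step is over by \<open>N = 2\<close>, so this bound does not depend on \<open>M\<close>.
\<close>

lemma profile'_mult_le: "profile' M N * N \<le> 9/2" if "M \<ge> 1" "N \<ge> 2"
proof -
  have "1 * 1 \<le> M * (N - 1)" using that by (intro mult_mono) auto
  then have eq: "profile' M N = 3/4 * step' (N - 2)"
    using step'_eq_0 [of "M * (N - 1)"] by (simp add: profile'_def)
  show ?thesis
  proof (cases "N \<ge> 3")
    case True
    then show ?thesis using step'_eq_0 [of "N - 2"] by (simp add: eq)
  next
    case False
    then have "3/4 * step' (N - 2) * N \<le> 3/2 * 3"
      using step'_le_2 [of "N - 2"] that by (intro mult_mono) auto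
    then show ?thesis by (simp add: eq)
  qed
qed

lemma profile_eq_1: "profile M N = 1" if "M \<ge> 1" "N \<ge> 3"
proof -
  have "1 * 1 \<le> M * (N - 1)" using that by (intro mult_mono) auto
  then show ?thesis
    using that step_eq_1 [of "M * (N - 1)"] step_eq_1 [of "N - 2"] by (simp add: profile_def)
qed

text \<open>
  On the middle half of the steep step the slope is comparable to \<open>M\<close>.
\<close>

lemma profile'_ge: "profile' M N \<ge> M/8"
  if "M > 0" "1 + 1/(4*M) \<le> N" "N \<le> 1 + 3/(4*M)"
proof -
  have "1 \<le> step' (M * (N - 1))"
    by (rule step'_ge_1) (use that in \<open>auto simp: field_simps\<close>)
  then have "M/8 * 1 \<le> M/8 * step' (M * (N - 1))"
    using that by (intro mult_left_mono) auto
  then show ?thesis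
    using step'_nonneg [of "N - 2"] by (simp add: profile'_def)
qed

section \<open>Radial deformations as test functions\<close>

lemma jacobian_radial:
  fixes x :: "real^'n"
  assumes "(p has_real_derivative p') (at (x \<bullet> x))"
  shows "((\<lambda>x. (p (x \<bullet> x) - 1) *\<^sub>R x) has_derivative
      (\<lambda>y. ((p (x \<bullet> x) - 1) *\<^sub>R mat 1 + (2 * p') *\<^sub>R dyad x) *v y)) (at x)"
    and "jacobian (\<lambda>x. (p (x \<bullet> x) - 1) *\<^sub>R x) (at x)
      = (p (x \<bullet> x) - 1) *\<^sub>R mat 1 + (2 * p') *\<^sub>R dyad x"
proof -
  let ?J = "(p (x \<bullet> x) - 1) *\<^sub>R mat 1 + (2 * p') *\<^sub>R dyad x"
  have d: "((\<lambda>x. x \<bullet> x) has_derivative (\<lambda>y. 2 * (x \<bullet> y))) (at x)"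
    by (auto intro!: derivative_eq_intros simp: inner_commute)
  have J: "?J *v y = (p (x \<bullet> x) - 1) *\<^sub>R y + (p' * (2 * (x \<bullet> y))) *\<^sub>R x" for y
    by (simp add: matrix_vector_mult_add_rdistrib dyad_mult_vec mult_ac
        flip: scaleR_matrix_vector_assoc)
  from has_derivative_compose [OF d assms [unfolded has_field_derivative_def]]
  have "((\<lambda>x. p (x \<bullet> x)) has_derivative (\<lambda>y. p' * (2 * (x \<bullet> y)))) (at x)" .
  then show *: "((\<lambda>x. (p (x \<bullet> x) - 1) *\<^sub>R x) has_derivative (\<lambda>y. ?J *v y)) (at x)"
    unfolding J by (auto intro!: derivative_eq_intros)
  show "jacobian (\<lambda>x. (p (x \<bullet> x) - 1) *\<^sub>R x) (at x) = ?J"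
    unfolding jacobian_def frechet_derivative_at [OF *, symmetric]
    by (rule matrix_of_matrix_vector_mul)
qed

text \<open>
  The field vanishes where \<open>|x|\<^sup>2 \<ge> R\<close>, and the ball of squared radius \<open>R\<close> stays away from the
  boundary of the ball of radius \<open>r\<close>.
\<close>

lemma radial_C1c:
  fixes p p' :: "real \<Rightarrow> real"
  assumes p: "\<And>N. (p has_real_derivative p' N) (at N)" and p': "continuous_on UNIV p'"
    and one: "\<And>N. N \<ge> R \<Longrightarrow> p N = 1" and r: "R < r\<^sup>2" "r > 0"
  shows "(\<lambda>x::real^'n. (p (x \<bullet> x) - 1) *\<^sub>R x) \<in> C1c (ball 0 r)" (is "?\<phi> \<in> _")
proof -
  have cp: "continuous_on UNIV p"
    using p by (meson DERIV_continuous continuous_at_imp_continuous_on)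
  have dyad: "continuous_on UNIV (dyad :: real^'n \<Rightarrow> _)"
    unfolding dyad_def by (intro continuous_intros)
  have "x \<bullet> x < R" if "?\<phi> x \<noteq> 0" for x :: "real^'n"
    using one [of "x \<bullet> x"] that by force
  then have "norm x \<le> sqrt R" if "?\<phi> x \<noteq> 0" for x :: "real^'n"
    using that by (force simp: norm_eq_sqrt_inner)
  then have supp: "closure {x. ?\<phi> x \<noteq> 0} \<subseteq> cball 0 (sqrt R)"
    by (intro closure_minimal) auto
  have "sqrt R < r"
    using r by (simp add: real_less_lsqrt)
  then have sub: "cball 0 (sqrt R) \<subseteq> ball (0::real^'n) r"
    by auto
  show ?thesis
    unfolding C1c_def
  proof (intro CollectI conjI allI)
    show "?\<phi> differentiable (at x)" for x
      using jacobian_radial(1) [OF p] by (rule differentiableI)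
    show "continuous_on UNIV (\<lambda>x. jacobian ?\<phi> (at x))"
      unfolding jacobian_radial(2) [OF p]
      by (intro continuous_intros dyad continuous_on_compose2 [OF cp] continuous_on_compose2 [OF p'])
        auto
    show "compact (closure {x. ?\<phi> x \<noteq> 0})"
      using supp by (meson bounded_cball bounded_subset closed_closure compact_eq_bounded_closed)
    show "closure {x. ?\<phi> x \<noteq> 0} \<subseteq> ball 0 r"
      using supp sub by blast
  qed
qed

section \<open>The integrand for radial deformations\<close>

text \<open>
  The integrand of the quasimonotonicity inequality for a radial deformation, as a function of
  \<open>a = p(|x|\<^sup>2)\<close> and \<open>b = 2 |x|\<^sup>2 p'(|x|\<^sup>2)\<close>; see \<open>integrand_radial\<close>.
\<close>

definition radial_density :: "nat \<Rightarrow> (real \<Rightarrow> real) \<Rightarrow> real \<Rightarrow> real \<Rightarrow> real" where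
  "radial_density n h a b = h (a ^ (n - 1) * (a + b))
     * (a ^ (n - 2) * (n * a * (a - 1) + b * (n * a - (real n - 1))))"

lemma integrand_radial:
  fixes x :: "real^'n"
  assumes p: "(p has_real_derivative p') (at (x \<bullet> x))"
    and n: "CARD('n) \<ge> 2" and pos: "p (x \<bullet> x) > 0" "p' \<ge> 0"
  defines "J \<equiv> jacobian (\<lambda>x. (p (x \<bullet> x) - 1) *\<^sub>R x) (at x)"
  shows "(h (det (mat 1 + J)) *\<^sub>R cof (mat 1 + J)) \<bullet> J
    = radial_density CARD('n) h (p (x \<bullet> x)) (2 * p' * (x \<bullet> x))"
proof -
  define F where "F = p (x \<bullet> x) *\<^sub>R mat 1 + (2 * p') *\<^sub>R dyad x"
  have F: "mat 1 + J = F" and J: "J = F - mat 1"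
    unfolding J_def jacobian_radial(2) [OF p] F_def by (simp_all add: algebra_simps)
  have cof: "cof F \<bullet> (F - mat 1)
      = p (x \<bullet> x) ^ (CARD('n) - 2) * (real CARD('n) * p (x \<bullet> x) * (p (x \<bullet> x) - 1)
        + (2 * p' * (x \<bullet> x)) * (real CARD('n) * p (x \<bullet> x) - (real CARD('n) - 1)))"
    unfolding F_def by (rule cof_inner_scale_id_plus_dyad [OF n pos(1) refl]) (use pos(2) in simp)
  have det: "det F = p (x \<bullet> x) ^ (CARD('n) - 1) * (p (x \<bullet> x) + 2 * p' * (x \<bullet> x))"
    unfolding F_def by (rule det_scale_id_plus_dyad)
  show ?thesis
    unfolding F unfolding J inner_scaleR_left cof det radial_density_def by (rule refl)
qed

lemma radial_density_bounded:
  assumes "continuous_on UNIV h"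
  obtains K where "K \<ge> 0"
    "\<And>a b. \<lbrakk>1/8 \<le> a; a \<le> 1; 0 \<le> b; b \<le> B\<rbrakk> \<Longrightarrow> radial_density n h a b \<le> K"
proof -
  have "continuous_on ({1/8..1} \<times> {0..B}) (\<lambda>(a, b). radial_density n h a b)"
    unfolding radial_density_def case_prod_unfold
    by (intro continuous_intros continuous_on_compose2 [OF assms]) auto
  then have "bounded ((\<lambda>(a, b). radial_density n h a b) ` ({1/8..1} \<times> {0..B}))"
    by (intro compact_imp_bounded compact_continuous_image compact_Times) auto
  then obtain K where K: "K > 0"
    "\<And>z. z \<in> {1/8..1} \<times> {0..B} \<Longrightarrow> norm (case z of (a, b) \<Rightarrow> radial_density n h a b) \<le> K"
    unfolding bounded_pos by blast
  show thesis
  proof (rule that)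
    show "K \<ge> 0" using K by simp
    show "radial_density n h a b \<le> K" if "1/8 \<le> a" "a \<le> 1" "0 \<le> b" "b \<le> B" for a b
      using K(2) [of "(a, b)"] that by auto
  qed
qed

text \<open>
  For \<open>a \<le> 1/4\<close> and \<open>n \<ge> 2\<close> the factor \<open>n a - (n - 1)\<close> of \<open>b\<close> is at most \<open>1 - 3n/4 \<le> -1/2\<close>, and the term
  \<open>n a (a - 1)\<close> is negative as well.  The other constants come from \<open>a \<ge> 1/8\<close> and \<open>a + b \<ge> c\<close>.
\<close>

lemma radial_density_le:
  assumes n: "n \<ge> 2" and h: "mono_on {0..} h"
    and a: "1/8 \<le> a" "a \<le> 1/4" and c: "0 \<le> c" "c \<le> b"
    and hc: "h ((1/8) ^ (n - 1) * c) \<ge> 0"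
  shows "radial_density n h a b \<le> - (h ((1/8) ^ (n - 1) * c) * ((1/8) ^ (n - 2) * (c / 2)))"
proof -
  have "(1/8) ^ (n - 1) * c \<le> a ^ (n - 1) * (a + b)"
    using a c by (intro mult_mono power_mono) auto
  then have h1: "h ((1/8) ^ (n - 1) * c) \<le> h (a ^ (n - 1) * (a + b))"
    using a c by (intro mono_onD [OF h]) auto
  have "n * a \<le> n * (1/4)"
    using a by (intro mult_left_mono) auto
  then have "real n * a - (n - 1) \<le> - (1/2)"
    using n by linarith
  then have "b * (real n * a - (n - 1)) \<le> b * - (1/2)"
    using c by (intro mult_left_mono) (auto simp: n)
  moreover have "n * a * (a - 1) \<le> 0"
    using a by (intro mult_nonneg_nonpos) auto
  ultimately have "c / 2 \<le> - (n * a * (a - 1) + b * (n * a - (real n - 1)))"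
    using n c by (simp add: of_nat_diff)
  then have "(1/8) ^ (n - 2) * (c / 2)
      \<le> a ^ (n - 2) * - (n * a * (a - 1) + b * (n * a - (real n - 1)))"
    using a c by (intro mult_mono power_mono) auto
  then have "h ((1/8) ^ (n - 1) * c) * ((1/8) ^ (n - 2) * (c / 2))
      \<le> h (a ^ (n - 1) * (a + b)) * (a ^ (n - 2) * - (n * a * (a - 1) + b * (n * a - (real n - 1))))"
  proof (rule mult_mono [OF h1])
    show "0 \<le> h (a ^ (n - 1) * (a + b))"
      using h1 hc by linarith
    show "0 \<le> (1/8) ^ (n - 2) * (c / 2)"
      using c by simp
  qed
  then show ?thesis
    unfolding radial_density_def mult_minus_right by (simp only: le_minus_iff)
qed

section \<open>Failure of quasimonotonicity at the identity\<close>

text \<open>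
  Since the dimension is at least \<open>2\<close> and \<open>s \<ge> 1\<close>, the difference of the powers of the two radii is
  at least the difference of their squares.
\<close>

lemma measure_annulus_ge:
  fixes s t :: real
  assumes "1 \<le> s" "s \<le> t" and n: "DIM('a::euclidean_space) \<ge> 2"
  shows "(t - s) * measure lborel (ball (0::'a) 1) \<le> measure lborel {x::'a. s \<le> x \<bullet> x \<and> x \<bullet> x \<le> t}"
proof -
  let ?n = "DIM('a)"
  have eq: "{x::'a. s \<le> x \<bullet> x \<and> x \<bullet> x \<le> t} = cball 0 (sqrt t) - ball 0 (sqrt s)"
    using assms by (auto simp: norm_eq_sqrt_inner)
  have "measure lborel (cball (0::'a) (sqrt t) - ball 0 (sqrt s))
      = measure lborel (cball (0::'a) (sqrt t)) - measure lborel (ball (0::'a) (sqrt s))"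
  proof (rule measure_Diff)
    have "sqrt s \<le> sqrt t" using assms by simp
    then show "ball (0::'a) (sqrt s) \<subseteq> cball 0 (sqrt t)"
      by (meson ball_subset_cball subset_cball order_trans)
  qed (use emeasure_lborel_cball_finite in \<open>auto simp: less_top\<close>)
  also have "\<dots> = (sqrt t ^ ?n - sqrt s ^ ?n) * measure lborel (ball (0::'a) 1)"
    using assms content_ball_conv_unit_ball [of "sqrt t" "0::'a"]
      content_ball_conv_unit_ball [of "sqrt s" "0::'a"]
    by (simp add: content_cball_conv_ball algebra_simps)
  finally have m: "measure lborel (cball (0::'a) (sqrt t) - ball 0 (sqrt s))
      = (sqrt t ^ ?n - sqrt s ^ ?n) * measure lborel (ball (0::'a) 1)" .
  have pow: "sqrt u ^ ?n = u * sqrt u ^ (?n - 2)" if "u \<ge> 1" for u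
  proof -
    have "?n = 2 + (?n - 2)" using n by simp
    from arg_cong [OF this, of "\<lambda>k. sqrt u ^ k"]
    have "sqrt u ^ ?n = (sqrt u)\<^sup>2 * sqrt u ^ (?n - 2)"
      by (simp only: power_add)
    then show ?thesis using that by simp
  qed
  have "t - s = (t - s) * 1" by simp
  also have "\<dots> \<le> (t - s) * sqrt s ^ (?n - 2)"
    using assms by (intro mult_left_mono one_le_power) auto
  also have "\<dots> = t * sqrt s ^ (?n - 2) - s * sqrt s ^ (?n - 2)"
    by (simp add: algebra_simps)
  also have "\<dots> \<le> t * sqrt t ^ (?n - 2) - s * sqrt s ^ (?n - 2)"
    using assms by (intro diff_right_mono mult_left_mono power_mono) auto
  finally have "t - s \<le> sqrt t ^ ?n - sqrt s ^ ?n"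
    using assms by (simp add: pow)
  then show ?thesis
    unfolding eq m by (intro mult_right_mono) auto
qed

text \<open>
  The shell is cut down to the set \<open>A\<close>, where the slope of the profile is at least \<open>M/8\<close>; there the
  integrand is at most \<open>- L\<close> with \<open>L\<close> of order \<open>M h(d M / 4)\<close>.  Its measure is at least \<open>\<omega> / (2 M)\<close>, so the
  powers of \<open>M\<close> cancel and the growth of \<open>h\<close> alone decides the sign of the integral.
\<close>

theorem not_quasimonotone_at_id_if_mono_unbounded:
  fixes h :: "real \<Rightarrow> real"
  assumes n: "CARD('n::finite) \<ge> 2" and cont: "continuous_on UNIV h"
    and mono: "mono_on {0..} h" and lim: "filterlim h at_top at_top"
  shows "\<not> quasimonotone_at (\<lambda>A::real^'n^'n. h (det A) *\<^sub>R cof A) (mat 1)"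
proof
  let ?n = "CARD('n)" and ?\<sigma> = "\<lambda>A::real^'n^'n. h (det A) *\<^sub>R cof A"
  assume "quasimonotone_at ?\<sigma> (mat 1)"
  moreover have \<sigma>: "continuous_on UNIV ?\<sigma>"
    by (intro continuous_intros continuous_on_cof continuous_on_compose2 [OF cont]
        continuous_on_det) auto
  moreover have "bounded_domain (ball (0::real^'n) 2)"
    by (simp add: bounded_domain_def connected_ball)
  ultimately have qm: "quasimonotone_on (ball 0 2) ?\<sigma> (mat 1)"
    using quasimonotone_on_domain_independent by blast

  define \<omega> where "\<omega> = measure lborel (ball (0::real^'n) 1)"
  define V where "V = measure lborel (cball (0::real^'n) 2)"
  define d where "d = (1/8 :: real) ^ (?n - 1)"
  define e where "e = (1/8 :: real) ^ (?n - 2)"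
  have pos: "\<omega> > 0" "d > 0" "e > 0" "V \<ge> 0"
    by (simp_all add: \<omega>_def V_def d_def e_def content_ball_pos)
  obtain T where T: "\<And>t. t \<ge> T \<Longrightarrow> h t \<ge> 0"
    using lim unfolding filterlim_at_top eventually_at_top_linorder by meson
  \<comment> \<open>Beyond \<open>B\<close>, the argument of \<open>h\<close> in \<open>radial_density_le\<close> is at least \<open>T\<close>; the value \<open>9\<close> bounds \<open>b\<close>
    outside \<open>|x|\<^sup>2 < 2\<close>, so that \<open>b > B\<close> can happen only where \<open>a \<le> 1/4\<close>.\<close>
  define B where "B = max 9 (T / d)"
  obtain K where K: "K \<ge> 0"
    "\<And>a b. \<lbrakk>1/8 \<le> a; a \<le> 1; 0 \<le> b; b \<le> B\<rbrakk> \<Longrightarrow> radial_density ?n h a b \<le> K"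
    using radial_density_bounded [OF cont] by metis
  \<comment> \<open>The bound is chosen so that \<open>L\<close> times the measure of \<open>A\<close> exceeds \<open>K * V\<close>.\<close>
  obtain U where U: "\<And>t. t \<ge> U \<Longrightarrow> h t \<ge> 16 * (K * V + 1) / (e * \<omega>)"
    using lim unfolding filterlim_at_top eventually_at_top_linorder by meson
  define M where "M = 4 * max B (U / d)"
  have M: "M \<ge> 1" "M / 4 \<ge> B" "M / 4 \<ge> U / d"
    by (auto simp: M_def B_def)
  have nonneg: "h (d * b) \<ge> 0" if "b \<ge> B" for b
  proof (rule T)
    have "T / d \<le> b" using that by (simp add: B_def)
    then show "T \<le> d * b" using pos by (simp add: field_simps)
  qed

  define \<phi> :: "real^'n \<Rightarrow> real^'n" where "\<phi> = (\<lambda>x. (profile M (x \<bullet> x) - 1) *\<^sub>R x)"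
  have \<phi>: "\<phi> \<in> C1c (ball 0 2)"
    unfolding \<phi>_def
    by (rule radial_C1c [OF DERIV_profile continuous_on_profile', where R = 3])
      (use M profile_eq_1 in auto)
  define G where "G x = ?\<sigma> (mat 1 + jacobian \<phi> (at x)) \<bullet> jacobian \<phi> (at x)" for x
  define a where "a x = profile M (x \<bullet> x)" for x :: "real^'n"
  define b where "b x = 2 * profile' M (x \<bullet> x) * (x \<bullet> x)" for x :: "real^'n"
  have G: "G x = radial_density ?n h (a x) (b x)" for x
    unfolding G_def \<phi>_def a_def b_def
    by (rule integrand_radial [OF DERIV_profile n])
      (use profile_ge [of M "x \<bullet> x"] profile'_nonneg M in auto)
  have ab: "1/8 \<le> a x" "a x \<le> 1" "0 \<le> b x" for x
    using profile_ge profile_le_1 profile'_nonneg M by (auto simp: a_def b_def)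

  have le_K: "G x \<le> K" for x
  proof (cases "b x \<le> B")
    case True
    then show ?thesis using K(2) ab by (simp add: G)
  next
    case False
    then have "9/2 < profile' M (x \<bullet> x) * (x \<bullet> x)"
      by (simp add: b_def B_def)
    then have x: "x \<bullet> x < 2"
      using profile'_mult_le [OF M(1), of "x \<bullet> x"] by linarith
    have "G x \<le> - (h (d * b x) * (e * (b x / 2)))"
      unfolding G d_def e_def
      by (rule radial_density_le [OF n mono])
        (use ab profile_le [of "x \<bullet> x" M] x nonneg [of "b x"] False in \<open>auto simp: a_def d_def\<close>)
    also have "\<dots> \<le> 0"
      using nonneg [of "b x"] False ab(3) [of x] pos by simp
    finally show ?thesis using K(1) by simp
  qed
  have zero: "G x = 0" if "x \<notin> cball 0 2" for x
  proof -
    have "x \<notin> closure {x. \<phi> x \<noteq> 0}"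
      using \<phi> that by (auto simp: C1c_def)
    then show ?thesis by (simp add: G_def jacobian_zero_outside)
  qed
  define A where "A = {x::real^'n. 1 + 1/(4*M) \<le> x \<bullet> x \<and> x \<bullet> x \<le> 1 + 3/(4*M)}"
  define L where "L = h (d * (M / 4)) * (e * (M / 4 / 2))"
  have le_L: "G x \<le> - L" if "x \<in> A" for x
  proof -
    have x: "1 + 1/(4*M) \<le> x \<bullet> x" "x \<bullet> x \<le> 1 + 3/(4*M)"
      using that by (auto simp: A_def)
    have "1/(4*M) \<ge> 0" "3/(4*M) \<le> 1"
      using M by (auto simp: field_simps)
    then have x12: "1 \<le> x \<bullet> x" "x \<bullet> x \<le> 2"
      using x by linarith+
    have "M / 8 * 1 \<le> profile' M (x \<bullet> x) * (x \<bullet> x)"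
      using profile'_ge [OF _ x] x12 M by (intro mult_mono) auto
    then have "M / 4 \<le> b x"
      by (simp add: b_def)
    then show ?thesis
      unfolding G d_def e_def L_def
      by (intro radial_density_le [OF n mono])
        (use ab profile_le [of "x \<bullet> x" M] x12 nonneg [of "M / 4"] M in \<open>auto simp: a_def d_def\<close>)
  qed
  have A_sub: "A \<subseteq> cball 0 2"
  proof
    fix x assume "x \<in> A"
    moreover have "3/(4*M) \<le> 3"
      using M by (auto simp: field_simps)
    ultimately have "x \<bullet> x \<le> 2\<^sup>2"
      by (simp add: A_def)
    then show "x \<in> cball 0 2"
      by (simp add: norm_le_square)
  qed
  have A_sets: "A \<in> sets lborel"
    unfolding A_def by measurable
  have A_fin: "emeasure lborel A < \<infinity>"
    using emeasure_mono [OF A_sub, of lborel] emeasure_lborel_cball_finite [of "0::real^'n" 2]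
    by (auto simp: less_top top_unique)

  \<comment> \<open>On \<open>A\<close>, which lies inside the ball, the two terms add up to \<open>- L\<close>.\<close>
  have bound: "G x \<le> K * indicator (cball 0 2) x - (K + L) * indicator A x" for x
    using le_K [of x] le_L [of x] zero [of x] A_sub by (auto simp: indicator_def)
  have "continuous_on UNIV (\<lambda>x. jacobian \<phi> (at x))"
    using \<phi> by (simp add: C1c_def)
  then have "continuous_on UNIV G"
    unfolding G_def by (intro continuous_intros continuous_on_compose2 [OF \<sigma>]) auto
  then have "integrable lborel (\<lambda>x. indicator (cball 0 2) x *\<^sub>R G x)"
    by (intro borel_integrable_compact) (auto intro: continuous_on_subset)
  also have "(\<lambda>x. indicator (cball 0 2) x *\<^sub>R G x) = G"
    using zero by (auto simp: indicator_def fun_eq_iff)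
  finally have int_G: "integrable lborel G" .
  have int_ind: "integrable lborel (\<lambda>x::real^'n. K * indicator (cball 0 2) x)"
    "integrable lborel (\<lambda>x. (K + L) * indicator A x)"
    using emeasure_lborel_cball_finite A_fin A_sets
    by (auto intro!: integrable_mult_right integrable_real_indicator)
  have "0 \<le> (LINT x:ball 0 2|lborel. G x)"
    using qm \<phi> unfolding quasimonotone_on_def G_def by blast
  also have "\<dots> = integral\<^sup>L lborel G"
    unfolding G_def [abs_def] by (rule set_integral_C1c [OF \<phi>])
  also have "\<dots> \<le> (LINT x|lborel. K * indicator (cball 0 2) x - (K + L) * indicator A x)"
    by (intro integral_mono int_G bound Bochner_Integration.integrable_diff int_ind)
  also have "\<dots> = K * V - (K + L) * measure lborel A"
    by (subst Bochner_Integration.integral_diff [OF int_ind]) (simp_all add: V_def)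
  finally have "(K + L) * measure lborel A \<le> K * V"
    by simp
  moreover have "K * measure lborel A \<ge> 0"
    using K(1) by simp
  ultimately have le: "L * measure lborel A \<le> K * V"
    by (simp add: algebra_simps)
  have "L \<ge> 0"
    using nonneg [OF M(2)] M pos by (simp add: L_def)
  have "(1 / (2 * M)) * \<omega> \<le> measure lborel A"
    using measure_annulus_ge [where 'a = "real^'n", of "1 + 1/(4*M)" "1 + 3/(4*M)"] n M
    by (simp add: A_def \<omega>_def divide_simps)
  then have "L * ((1 / (2 * M)) * \<omega>) \<le> L * measure lborel A"
    using \<open>L \<ge> 0\<close> by (rule mult_left_mono)
  also have "L * ((1 / (2 * M)) * \<omega>) = h (d * (M / 4)) * (e * \<omega> / 16)"
    using M by (simp add: L_def)
  finally have "h (d * (M / 4)) * (e * \<omega> / 16) \<le> K * V"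
    using le by simp
  moreover have "16 * (K * V + 1) / (e * \<omega>) \<le> h (d * (M / 4))"
    by (rule U) (use M(3) pos in \<open>simp add: field_simps\<close>)
  then have "K * V + 1 \<le> h (d * (M / 4)) * (e * \<omega> / 16)"
    using pos by (simp add: field_simps)
  ultimately show False by simp
qed

lemma rpow_ge_1: "rpow t k \<ge> 1" if "t \<ge> 1" "k \<ge> 0"
  using that by (simp add: rpow_def ge_one_powr_ge_zero)

lemma rpow_nonneg: "rpow t k \<ge> 0"
  by (simp add: rpow_def)

text \<open>
  The lower bound makes \<open>h\<close> nondecreasing on \<open>[0, \<infinity>)\<close>, and as \<open>t\<^bsup>k1\<^esup> \<ge> 1\<close> for \<open>t \<ge> 1\<close> it forces \<open>h\<close> to
  grow at least linearly there.
\<close>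

theorem theorem3p4:
  fixes h :: "real \<Rightarrow> real" and lam Lam k1 k2 :: real
  assumes "CARD('n::finite) \<ge> 2"
    and "h C1_differentiable_on UNIV"
    and "0 < lam" and "lam < Lam"
    and "0 \<le> k1" and "k1 \<le> k2" and "k2 < k1 + 1"
    and "\<forall>t\<ge>0. lam * rpow t k1 \<le> deriv h t \<and> deriv h t \<le> Lam * (rpow t k2 + 1)"
  shows "\<not> quasimonotone_at (\<lambda>A::real^'n^'n. h (det A) *\<^sub>R cof A) (mat 1)"
proof (rule not_quasimonotone_at_id_if_mono_unbounded)
  have D: "(h has_real_derivative deriv h t) (at t)" for t
    using assms(2) unfolding C1_differentiable_on_eq
    by (simp add: DERIV_deriv_iff_real_differentiable)
  then show "continuous_on UNIV h"
    by (meson DERIV_continuous continuous_at_imp_continuous_on)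
  have "deriv h t \<ge> 0" if "t \<ge> 0" for t
  proof -
    have "0 \<le> lam * rpow t k1"
      using assms(3) rpow_nonneg by simp
    also have "\<dots> \<le> deriv h t"
      using assms(8) that by simp
    finally show ?thesis .
  qed
  then have "h r \<le> h s" if "0 \<le> r" "r \<le> s" for r s
    using that D by (intro DERIV_nonneg_imp_nondecreasing [of r s h]) (meson order_trans)+
  then show "mono_on {0..} h"
    by (simp add: mono_on_def)
  have linear: "h 1 + lam * (t - 1) \<le> h t" if "t \<ge> 1" for t
  proof -
    have "lam \<le> deriv h s" if "s \<ge> 1" for s
    proof -
      have "lam * 1 \<le> lam * rpow s k1"
        using assms(3,5) rpow_ge_1 that by (intro mult_left_mono) auto
      also have "\<dots> \<le> deriv h s"
        using assms(8) that by simp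
      finally show ?thesis by simp
    qed
    moreover have "((\<lambda>s. h s - lam * s) has_real_derivative deriv h s - lam) (at s)" for s
      by (auto intro!: derivative_eq_intros D)
    ultimately have "h 1 - lam * 1 \<le> h t - lam * t"
      using \<open>t \<ge> 1\<close> by (intro DERIV_nonneg_imp_nondecreasing [of 1 t "\<lambda>s. h s - lam * s"])
        (auto intro!: exI)
    then show ?thesis by (simp add: algebra_simps)
  qed
  show "filterlim h at_top at_top"
    unfolding filterlim_at_top eventually_at_top_linorder
  proof (intro allI exI impI)
    fix Z t :: real
    assume t: "t \<ge> max 1 (1 + (Z - h 1) / lam)"
    then have "Z - h 1 \<le> lam * (t - 1)"
      using assms(3) by (simp add: field_simps)
    then show "Z \<le> h t" using linear [of t] t by simp
  qed
qed (rule assms(1))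

end
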